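(* Let $X$ be a Banach space and $E\subset X$ a nonempty closed convex subset. Let $T:E\to E$ be a contractive-like operator, i.e. there are a constant $\delta\in[0,1)$ and a strictly increasing continuous function $\varphi:[0,\infty)\to[0,\infty)$ with $\varphi(0)=0$ such that $\|Tx-Ty\|\leq\delta\|x-y\|+\varphi(\|x-Tx\|)$ for all $x,y\in E$. Assume that the set $F_T$ of fixed points of $T$ is nonempty. Let $\varepsilon>0$ and let $\widetilde{T}:E\to E$ be an approximate operator of $T$, i.e. $\|Tx-\widetilde{T}x\|\leq\varepsilon$ for all $x\in E$. Let $\{\alpha_n\}_{n=0}^\infty$ and $\{\beta_n\}_{n=0}^\infty$ be real sequences in $[0,1)$ satisfying (i) $\frac12\leq\alpha_n$ for all $n\in\mathbb{N}$, and (ii) $\sum_{n=0}^\infty\alpha_n=\infty$. Let $\{x_n\}_{n=0}^\infty$ and $\{u_n\}_{n=0}^\infty$ be the S-iterations associated to $T$ (starting from $x_0\in E$) and to $\widetilde{T}$ (starting from $u_0\in E$), respectively, both with these parameter sequences. If $p=Tp$ and $q=\widetilde{T}q$, then $$\|p-q\|\leq\frac{3\varepsilon}{1-\delta}.$$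
   Context: $\mathbb{N}$ denotes the set of nonnegative integers. For a self-map $S:E\to E$, the S-iteration associated to $S$ with parameters $\{\alpha_n\}$, $\{\beta_n\}$, starting from $x_0\in E$, is the sequence $\{x_n\}$ given for $n\in\mathbb{N}$ by $$x_{n+1}=(1-\alpha_n)Sx_n+\alpha_n Sy_n,\qquad y_n=(1-\beta_n)x_n+\beta_n Sx_n.$$ *)

theory Defs
  imports "HOL-Analysis.Analysis"
begin

text \<open>
  A self-map of a subset \<open>E\<close> is a total function on the ambient type together with membership in
  \<open>E \<rightarrow> E\<close>; its values outside \<open>E\<close> are irrelevant. Likewise \<open>\<phi> : [0,\<infinity>) \<rightarrow> [0,\<infinity>)\<close> is constrained
  on \<open>{0..}\<close> only.
\<close>

definition contractive_like_on ::
  "'a::real_normed_vector set \<Rightarrow> ('a \<Rightarrow> 'a) \<Rightarrow> real \<Rightarrow> (real \<Rightarrow> real) \<Rightarrow> bool" where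
  "contractive_like_on E T \<delta> \<phi> \<longleftrightarrow>
     T \<in> E \<rightarrow> E \<and>
     \<delta> \<in> {0..<1} \<and>
     \<phi> \<in> {0..} \<rightarrow> {0..} \<and> strict_mono_on {0..} \<phi> \<and> continuous_on {0..} \<phi> \<and> \<phi> 0 = 0 \<and>
     (\<forall>x\<in>E. \<forall>y\<in>E. norm (T x - T y) \<le> \<delta> * norm (x - y) + \<phi> (norm (x - T x)))"

definition fixed_points_on :: "'a set \<Rightarrow> ('a \<Rightarrow> 'a) \<Rightarrow> 'a set" where
  "fixed_points_on E T = {x \<in> E. T x = x}"

definition approximate_operator_on ::
  "'a::real_normed_vector set \<Rightarrow> ('a \<Rightarrow> 'a) \<Rightarrow> real \<Rightarrow> ('a \<Rightarrow> 'a) \<Rightarrow> bool" where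
  "approximate_operator_on E T \<epsilon> T' \<longleftrightarrow>
     T' \<in> E \<rightarrow> E \<and> (\<forall>x\<in>E. norm (T x - T' x) \<le> \<epsilon>)"

definition S_iteration ::
  "('a::real_vector \<Rightarrow> 'a) \<Rightarrow> (nat \<Rightarrow> real) \<Rightarrow> (nat \<Rightarrow> real) \<Rightarrow> 'a \<Rightarrow> (nat \<Rightarrow> 'a) \<Rightarrow> bool" where
  "S_iteration S \<alpha> \<beta> x0 x \<longleftrightarrow>
     x 0 = x0 \<and>
     (\<forall>n. let y = (1 - \<beta> n) *\<^sub>R x n + \<beta> n *\<^sub>R S (x n)
          in x (Suc n) = (1 - \<alpha> n) *\<^sub>R S (x n) + \<alpha> n *\<^sub>R S y)"

end

theory Submission
  imports Defs
begin

text \<open>The two fixed points are compared directly, through the intermediate point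
  \<open>T q\<close>. Since \<open>p\<close> is fixed by \<open>T\<close>, the contractive-like
  inequality based at \<open>p\<close> loses its \<phi> term, so \<open>T q\<close> lies within
  \<open>\<delta> * norm (p - q)\<close> of \<open>p\<close>; since \<open>q\<close> is fixed by
  \<open>T'\<close>, the point \<open>T q\<close> lies within \<epsilon> of \<open>q\<close>.
  Absorbing the \<delta> term on the left gives the bound
  \<open>\<epsilon> / (1 - \<delta>)\<close>, which is sharper than the stated one.\<close>

lemma contractive_like_fixed_points_dist_le:
  assumes T: "contractive_like_on E T \<delta> \<phi>" and T': "approximate_operator_on E T \<epsilon> T'"
    and p: "p \<in> fixed_points_on E T" and q: "q \<in> fixed_points_on E T'"
  shows "norm (p - q) \<le> \<epsilon> / (1 - \<delta>)"
proof -
  have p': "p \<in> E" "T p = p" and q': "q \<in> E" "T' q = q"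
    using p q by (auto simp: fixed_points_on_def)
  \<comment> \<open>The inequality is not symmetric: \<open>p\<close> must take the first slot, so
    that \<phi> is evaluated at \<open>norm (p - T p) = 0\<close>. With \<open>q\<close> there, a
    term in \<open>norm (q - T q)\<close> would remain.\<close>
  have "norm (T p - T q) \<le> \<delta> * norm (p - q) + \<phi> (norm (p - T p))"
    and \<phi>: "\<phi> 0 = 0" and \<delta>: "\<delta> < 1"
    using T p'(1) q'(1) by (auto simp: contractive_like_on_def)
  then have "norm (p - T q) \<le> \<delta> * norm (p - q)"
    using p'(2) by simp
  moreover have "norm (T q - q) \<le> \<epsilon>"
    using T' q' unfolding approximate_operator_on_def by force
  moreover have "norm (p - q) \<le> norm (p - T q) + norm (T q - q)"
    using norm_triangle_ineq[of "p - T q" "T q - q"] by simp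
  ultimately have "(1 - \<delta>) * norm (p - q) \<le> \<epsilon>"
    by (simp add: algebra_simps)
  then show ?thesis
    using \<delta> by (simp add: pos_le_divide_eq mult.commute)
qed

theorem theorem4:
  fixes E :: "'a::banach set"
    and T T' :: "'a \<Rightarrow> 'a"
    and \<delta> \<epsilon> :: real
    and \<phi> :: "real \<Rightarrow> real"
    and \<alpha> \<beta> :: "nat \<Rightarrow> real"
    and x0 u0 p q :: 'a
    and x u :: "nat \<Rightarrow> 'a"
  assumes "E \<noteq> {}" and "closed E" and "convex E"
    and "contractive_like_on E T \<delta> \<phi>"
    and "fixed_points_on E T \<noteq> {}"
    and "\<epsilon> > 0"
    and "approximate_operator_on E T \<epsilon> T'"
    and "\<And>n. \<alpha> n \<in> {0..<1}" and "\<And>n. \<beta> n \<in> {0..<1}"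
    and "\<And>n. 1 / 2 \<le> \<alpha> n"
    and "filterlim (\<lambda>n. \<Sum>k<n. \<alpha> k) at_top sequentially"
    and "x0 \<in> E" and "S_iteration T \<alpha> \<beta> x0 x"
    and "u0 \<in> E" and "S_iteration T' \<alpha> \<beta> u0 u"
    and "p \<in> fixed_points_on E T" and "q \<in> fixed_points_on E T'"
  shows "norm (p - q) \<le> 3 * \<epsilon> / (1 - \<delta>)"
proof -
  have "norm (p - q) \<le> \<epsilon> / (1 - \<delta>)"
    by (rule contractive_like_fixed_points_dist_le) fact+
  \<comment> \<open>The factor 3 is pure slack: \<epsilon> and \<open>1 - \<delta>\<close> are
    positive.\<close>
  also have "\<dots> \<le> 3 * \<epsilon> / (1 - \<delta>)"
    using assms(4,6) by (intro divide_right_mono) (auto simp: contractive_like_on_def)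
  finally show ?thesis .
qed

end
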